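(* Let $k$ be a positive integer, let $s\geq 1$ and $t\geq 2$ be integers, and let $n\geq 2k+1$. Then \[ ex(n,K_{s,t}^*,M_{k+1})=\max\left\{\binom{2k+1}{s+t}\binom{s+t}{t},\ \binom{k}{s}\binom{n-s}{t}+(n-k)\binom{k}{s+t-1}\binom{s+t-1}{t}\right\}. \]
   Context: All graphs are simple. $M_{k+1}$ denotes a matching with $k+1$ edges. $K^*_{s,t}$ is the graph obtained from the complete bipartite graph $K_{s,t}$ by replacing the part of size $s$ by a clique on those $s$ vertices (so it has $s+t$ vertices: an $s$-clique, $t$ further pairwise nonadjacent vertices, and all edges between the clique and these $t$ vertices). For graphs $T$ and $F$, $ex(n,T,F)$ is the maximum number of copies of $T$ (subgraphs isomorphic to $T$) in a graph on $n$ vertices that contains no subgraph isomorphic to $F$. Binomial coefficients $\binom{a}{b}$ are $0$ when $b>a$. *)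

theory Defs
  imports Complex_Main
begin

type_synonym 'a ugraph = "'a set \<times> 'a set set"

abbreviation verts :: "'a ugraph \<Rightarrow> 'a set" where
  "verts G \<equiv> fst G"

abbreviation edges :: "'a ugraph \<Rightarrow> 'a set set" where
  "edges G \<equiv> snd G"

definition simple_graph :: "'a ugraph \<Rightarrow> bool" where
  "simple_graph G \<longleftrightarrow> finite (verts G) \<and> (\<forall>e\<in>edges G. e \<subseteq> verts G \<and> card e = 2)"

text \<open>Subgraphs need not be induced.\<close>

definition is_subgraph :: "'a ugraph \<Rightarrow> 'a ugraph \<Rightarrow> bool" where
  "is_subgraph H G \<longleftrightarrow> simple_graph H \<and> verts H \<subseteq> verts G \<and> edges H \<subseteq> edges G"

definition graph_iso :: "'a ugraph \<Rightarrow> 'b ugraph \<Rightarrow> bool" where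
  "graph_iso G H \<longleftrightarrow> (\<exists>f. bij_betw f (verts G) (verts H) \<and>
     (\<forall>u\<in>verts G. \<forall>v\<in>verts G. {u, v} \<in> edges G \<longleftrightarrow> {f u, f v} \<in> edges H))"

definition copies :: "'b ugraph \<Rightarrow> 'a ugraph \<Rightarrow> 'a ugraph set" where
  "copies T G = {H. is_subgraph H G \<and> graph_iso H T}"

text \<open>
  Vertices of the host graphs are natural numbers; every finite graph is isomorphic to such a
  graph. The set below is finite for every \<open>n\<close> (lemma \<open>finite_copy_counts\<close>), so \<open>Max\<close> is the true
  maximum whenever some graph on \<open>n\<close> vertices contains no copy of \<open>F\<close>.
\<close>

definition copy_counts :: "nat \<Rightarrow> 'b ugraph \<Rightarrow> 'c ugraph \<Rightarrow> nat set" where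
  "copy_counts n T F =
     {card (copies T G) |G :: nat ugraph.
        simple_graph G \<and> card (verts G) = n \<and> copies F G = {}}"

definition ex :: "nat \<Rightarrow> 'b ugraph \<Rightarrow> 'c ugraph \<Rightarrow> nat" where
  "ex n T F = Max (copy_counts n T F)"

definition matching_graph :: "nat \<Rightarrow> nat ugraph" where
  "matching_graph m = ({..<2 * m}, {{2 * i, 2 * i + 1} |i. i < m})"

text \<open>The clique is \<open>{..<s}\<close>, the independent part is \<open>{s..<s + t}\<close>.\<close>

definition K_star :: "nat \<Rightarrow> nat \<Rightarrow> nat ugraph" where
  "K_star s t = ({..<s + t},
     {{u, v} |u v. u \<in> {..<s} \<and> v \<in> {s..<s + t}} \<union>
     {{u, v} |u v. u \<in> {..<s} \<and> v \<in> {..<s} \<and> u \<noteq> v})"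

lemma simple_graph_matching_graph: "simple_graph (matching_graph m)"
  by (auto simp: simple_graph_def matching_graph_def)

lemma simple_graph_K_star: "simple_graph (K_star s t)"
  by (auto simp: simple_graph_def K_star_def card_insert_if)

lemma copies_subset: "copies T G \<subseteq> Pow (verts G) \<times> Pow (Pow (verts G))"
  by (force simp: copies_def is_subgraph_def simple_graph_def)

lemma finite_copies: "simple_graph G \<Longrightarrow> finite (copies T G)"
  by (rule finite_subset[OF copies_subset]) (simp add: simple_graph_def)

lemma finite_copy_counts: "finite (copy_counts n T F)"
proof (rule finite_subset)
  show "copy_counts n T F \<subseteq> {..2 ^ n * 2 ^ 2 ^ n}"
  proof
    fix c assume "c \<in> copy_counts n T F"
    then obtain G :: "nat ugraph" where G: "simple_graph G" "card (verts G) = n"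
      and c: "c = card (copies T G)"
      by (auto simp: copy_counts_def)
    have fin: "finite (verts G)" using G(1) by (simp add: simple_graph_def)
    have "c \<le> card (Pow (verts G) \<times> Pow (Pow (verts G)))"
      unfolding c by (rule card_mono[OF _ copies_subset]) (simp add: fin)
    also have "\<dots> = 2 ^ n * 2 ^ 2 ^ n"
      using fin G(2) by (simp add: card_cartesian_product card_Pow)
    finally show "c \<in> {..2 ^ n * 2 ^ 2 ^ n}" by simp
  qed
qed simp

lemma copy_counts_matching_nonempty:
  assumes "m \<ge> 1"
  shows "copy_counts n T (matching_graph m) \<noteq> {}"
proof -
  let ?G = "({..<n}, {}) :: nat ugraph"
  have "copies (matching_graph m) ?G = {}"
  proof (rule ccontr)
    assume "copies (matching_graph m) ?G \<noteq> {}"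
    then obtain H where H: "is_subgraph H ?G" "graph_iso H (matching_graph m)"
      by (auto simp: copies_def)
    obtain f where f: "bij_betw f (verts H) {..<2 * m}"
      and e: "\<And>u v. u \<in> verts H \<Longrightarrow> v \<in> verts H \<Longrightarrow>
        {u, v} \<in> edges H \<longleftrightarrow> {f u, f v} \<in> edges (matching_graph m)"
      using H(2) by (auto simp: graph_iso_def matching_graph_def)
    have "0 \<in> f ` verts H" "1 \<in> f ` verts H"
      using f assms by (auto simp: bij_betw_def)
    then obtain u v where uv: "u \<in> verts H" "v \<in> verts H" "f u = 0" "f v = 1"
      by (metis imageE)
    have "{f u, f v} \<in> edges (matching_graph m)"
      using uv assms by (auto simp: matching_graph_def intro!: exI[of _ 0])
    with e uv have "{u, v} \<in> edges H" by blast
    with H(1) show False by (auto simp: is_subgraph_def)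
  qed
  moreover have "simple_graph ?G" "card (verts ?G) = n"
    by (auto simp: simple_graph_def)
  ultimately show ?thesis unfolding copy_counts_def by blast
qed

end

theory Submission
  imports Defs "HOL-Combinatorics.Transposition"
begin

text \<open>
  A copy of \<open>K_star s t\<close> with \<open>t \<ge> 2\<close> is the same as a pair \<open>(S, T)\<close> of disjoint sets such that
  \<open>S\<close> is an \<open>s\<close>-clique completely joined to the \<open>t\<close>-set \<open>T\<close>. Shifting a graph (replacing \<open>j\<close> by
  \<open>i < j\<close> in every edge where this yields a new edge) creates no larger matching and loses no
  such pairs in number, so the host graph may be assumed stable under all shifts. As the pairs
  \<open>{a, 2k + 1 - a}\<close>, \<open>a \<le> k\<close>, form a matching of size \<open>k + 1\<close>, one of them is a non-edge, and
  stability puts the graph inside the join of \<open>K_a\<close> with the union of \<open>K_{2k+1-2a}\<close> and isolated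
  vertices. The number of pairs in the latter graph is a convex function of \<open>a\<close>, so it is largest
  at \<open>a = 0\<close> or \<open>a = k\<close>; these are the two terms of the maximum.
\<close>

section \<open>Matchings and pairs spanning a copy\<close>

text \<open>Encoded by an enumeration of the matched vertices, so that moving a matching by a
  transposition or a relabelling is composition with \<open>g\<close>.\<close>

definition has_matching :: "'a set set \<Rightarrow> nat \<Rightarrow> bool" where
  "has_matching E m \<longleftrightarrow>
     (\<exists>g. inj_on g {..<2 * m} \<and> (\<forall>i<m. {g (2 * i), g (2 * i + 1)} \<in> E))"

text \<open>Edges within \<open>T\<close> are left free because copies need not be induced.\<close>

definition stars :: "nat \<Rightarrow> nat \<Rightarrow> 'a set set \<Rightarrow> ('a set \<times> 'a set) set" where
  "stars s t E = {(S, T). finite S \<and> finite T \<and> card S = s \<and> card T = t \<and> S \<inter> T = {} \<and>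
     (\<forall>u\<in>S. \<forall>v\<in>S \<union> T. u \<noteq> v \<longrightarrow> {u, v} \<in> E)}"

lemma less_double_cases:
  fixes x m :: nat
  assumes "x < 2 * m"
  obtains i where "i < m" "x = 2 * i \<or> x = 2 * i + 1"
  using assms by (intro that[of "x div 2"]) presburger+

lemma matching_graph_edge_iff:
  "{x, y} \<in> edges (matching_graph m) \<longleftrightarrow>
     (\<exists>i<m. x = 2 * i \<and> y = 2 * i + 1 \<or> y = 2 * i \<and> x = 2 * i + 1)"
  by (auto simp: matching_graph_def doubleton_eq_iff)

lemma K_star_edge_iff:
  "{x, y} \<in> edges (K_star s t) \<longleftrightarrow>
     x \<noteq> y \<and> x < s + t \<and> y < s + t \<and> (x < s \<or> y < s)"
proof (cases "x < s"; cases "y < s")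
qed (auto simp: K_star_def doubleton_eq_iff not_less)

lemma copies_matching_graph_nonempty_iff:
  assumes G: "simple_graph G"
  shows "copies (matching_graph m) G \<noteq> {} \<longleftrightarrow> has_matching (edges G) m"
proof
  assume "copies (matching_graph m) G \<noteq> {}"
  then obtain H f where H: "is_subgraph H G" and f: "bij_betw f (verts H) {..<2 * m}"
    and e: "\<And>u v. u \<in> verts H \<Longrightarrow> v \<in> verts H \<Longrightarrow>
        {u, v} \<in> edges H \<longleftrightarrow> {f u, f v} \<in> edges (matching_graph m)"
    by (auto simp: copies_def graph_iso_def matching_graph_def)
  let ?g = "inv_into (verts H) f"
  have g: "bij_betw ?g {..<2 * m} (verts H)"
    using f by (rule bij_betw_inv_into)
  have fg: "f (?g x) = x" and gV: "?g x \<in> verts H" if "x < 2 * m" for x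
    using that bij_betw_inv_into_right[OF f] bij_betwE[OF g] by auto
  have "{?g (2 * i), ?g (2 * i + 1)} \<in> edges G" if "i < m" for i
  proof -
    have "{?g (2 * i), ?g (2 * i + 1)} \<in> edges H"
      using that by (subst e) (auto simp: gV fg matching_graph_edge_iff)
    then show ?thesis using H by (auto simp: is_subgraph_def)
  qed
  then show "has_matching (edges G) m"
    unfolding has_matching_def using g by (auto simp: bij_betw_def)
next
  assume "has_matching (edges G) m"
  then obtain g where g: "inj_on g {..<2 * m}"
    and gE: "\<And>i. i < m \<Longrightarrow> {g (2 * i), g (2 * i + 1)} \<in> edges G"
    by (auto simp: has_matching_def)
  let ?H = "(g ` {..<2 * m}, {{g (2 * i), g (2 * i + 1)} |i. i < m})"
  have eq: "g x = g y \<longleftrightarrow> x = y" if "x < 2 * m" "y < 2 * m" for x y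
    using g that by (auto simp: inj_on_eq_iff)
  have "simple_graph ?H"
    by (auto simp: simple_graph_def card_insert_if eq)
  moreover have "g ` {..<2 * m} \<subseteq> verts G"
  proof (safe)
    fix x assume "x < 2 * m"
    then obtain i where "i < m" "x = 2 * i \<or> x = 2 * i + 1"
      by (rule less_double_cases)
    then show "g x \<in> verts G"
      using gE[of i] G by (auto simp: simple_graph_def)
  qed
  ultimately have "is_subgraph ?H G"
    using gE by (auto simp: is_subgraph_def)
  moreover have "graph_iso ?H (matching_graph m)"
    unfolding graph_iso_def
  proof (intro exI conjI ballI)
    let ?f = "inv_into {..<2 * m} g"
    show "bij_betw ?f (verts ?H) (verts (matching_graph m))"
      using g by (auto simp: matching_graph_def intro!: bij_betw_inv_into bij_betw_imageI)
    fix u v assume "u \<in> verts ?H" "v \<in> verts ?H"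
    then obtain x y where xy: "x < 2 * m" "y < 2 * m" "u = g x" "v = g y" by auto
    have "{g x, g y} \<in> edges ?H \<longleftrightarrow>
       (\<exists>i<m. x = 2 * i \<and> y = 2 * i + 1 \<or> y = 2 * i \<and> x = 2 * i + 1)"
      using xy eq by (fastforce simp: doubleton_eq_iff)
    then show "{u, v} \<in> edges ?H \<longleftrightarrow> {?f u, ?f v} \<in> edges (matching_graph m)"
      using g xy by (simp add: inv_into_f_f matching_graph_edge_iff)
  qed
  ultimately show "copies (matching_graph m) G \<noteq> {}"
    by (auto simp: copies_def)
qed

text \<open>Both \<open>S\<close> and \<open>T\<close> are nonempty, so every vertex of the pair is
  an end of an edge joining them.\<close>

lemma stars_subset:
  assumes "simple_graph (V, E)" "s \<ge> 1" "t \<ge> 1"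
  shows "stars s t E \<subseteq> Pow V \<times> Pow V"
proof (clarsimp simp: stars_def)
  fix S T :: "'a set"
  assume st: "finite S" "finite T" "S \<inter> T = {}" "s = card S" "t = card T"
    and E: "\<forall>u\<in>S. \<forall>v\<in>S \<union> T. u \<noteq> v \<longrightarrow> {u, v} \<in> E"
  have ST: "{x, y} \<in> E" if "x \<in> S" "y \<in> T" for x y
  proof -
    have "x \<noteq> y" using that st(3) by auto
    then show ?thesis using E that by simp
  qed
  have V: "x \<in> V \<and> y \<in> V" if "{x, y} \<in> E" for x y
    using assms(1) that by (auto simp: simple_graph_def)
  obtain u v where "u \<in> S" "v \<in> T" using st assms by fastforce
  then show "S \<subseteq> V \<and> T \<subseteq> V" using V[OF ST] by auto
qed

lemma finite_stars:
  assumes "simple_graph (V, E)" "s \<ge> 1" "t \<ge> 1"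
  shows "finite (stars s t E)"
  by (rule finite_subset[OF stars_subset[OF assms]]) (use assms in \<open>simp add: simple_graph_def\<close>)

lemma stars_mono: "E \<subseteq> E' \<Longrightarrow> stars s t E \<subseteq> stars s t E'"
  by (auto simp: stars_def)

definition star_graph :: "'a set \<Rightarrow> 'a set \<Rightarrow> 'a ugraph" where
  "star_graph S T = (S \<union> T, {{u, v} |u v. u \<in> S \<and> v \<in> S \<union> T \<and> u \<noteq> v})"

lemma star_graph_edge_iff:
  "{x, y} \<in> edges (star_graph S T) \<longleftrightarrow>
     x \<noteq> y \<and> x \<in> S \<union> T \<and> y \<in> S \<union> T \<and> (x \<in> S \<or> y \<in> S)"
  by (auto simp: star_graph_def doubleton_eq_iff)

lemma simple_graph_star_graph:
  "finite S \<Longrightarrow> finite T \<Longrightarrow> simple_graph (star_graph S T)"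
  by (auto simp: simple_graph_def star_graph_def card_insert_if)

text \<open>With at least two vertices outside the clique, the clique is recovered as the set of
  vertices adjacent to all others.\<close>

lemma star_graph_clique:
  assumes "S \<inter> T = {}" "card T \<ge> 2"
  shows "{u \<in> verts (star_graph S T). \<forall>v\<in>verts (star_graph S T). v \<noteq> u \<longrightarrow>
           {u, v} \<in> edges (star_graph S T)} = S"
proof -
  have "\<exists>v\<in>T. v \<noteq> u" for u
  proof (rule ccontr)
    assume "\<not> (\<exists>v\<in>T. v \<noteq> u)"
    then have "T \<subseteq> {u}" by auto
    then have "card T \<le> 1" using card_mono[of "{u}" T] by auto
    then show False using assms by simp
  qed
  then show ?thesis using assms
    unfolding star_graph_edge_iff by (auto simp: star_graph_def)
qed

text \<open>Bijections of the two parts are glued; adjacency on either side depends only on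
  distinctness and on membership in the clique.\<close>

lemma star_graph_iso_K_star:
  assumes "finite S" "finite T" "S \<inter> T = {}"
  shows "graph_iso (star_graph S T) (K_star (card S) (card T))"
proof -
  obtain f where f: "bij_betw f S {..<card S}"
    using ex_bij_betw_finite_nat[OF assms(1)] by (auto simp: atLeast0LessThan)
  obtain g where g: "bij_betw g T {card S..<card S + card T}"
    using finite_same_card_bij[of T "{card S..<card S + card T}"] assms by auto
  let ?h = "\<lambda>x. if x \<in> S then f x else g x"
  have h1: "bij_betw ?h S {..<card S}"
    using f by (rule bij_betw_cong[THEN iffD1, rotated]) auto
  have h2: "bij_betw ?h T {card S..<card S + card T}"
    using g by (rule bij_betw_cong[THEN iffD1, rotated]) (use assms in auto)
  have h: "bij_betw ?h (S \<union> T) ({..<card S} \<union> {card S..<card S + card T})"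
    by (rule bij_betw_combine[OF h1 h2]) auto
  have U: "{..<card S} \<union> {card S..<card S + card T} = {..<card S + card T}" by auto
  show ?thesis unfolding graph_iso_def
  proof (intro exI conjI ballI)
    show "bij_betw ?h (verts (star_graph S T)) (verts (K_star (card S) (card T)))"
      using h U by (simp add: star_graph_def K_star_def)
    fix u v assume "u \<in> verts (star_graph S T)" "v \<in> verts (star_graph S T)"
    then have uv: "u \<in> S \<union> T" "v \<in> S \<union> T" by (auto simp: star_graph_def)
    have lt: "?h x < card S \<longleftrightarrow> x \<in> S" "?h x < card S + card T" if "x \<in> S \<union> T" for x
      using that bij_betwE[OF h1] bij_betwE[OF h2] by fastforce+
    have "?h u = ?h v \<longleftrightarrow> u = v"
      using inj_on_eq_iff[OF bij_betw_imp_inj_on[OF h] uv] .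
    with uv lt[OF uv(1)] lt[OF uv(2)]
    show "{u, v} \<in> edges (star_graph S T) \<longleftrightarrow> {?h u, ?h v} \<in> edges (K_star (card S) (card T))"
      unfolding star_graph_edge_iff K_star_edge_iff by blast
  qed
qed

text \<open>\<open>S\<close> and \<open>T\<close> are the preimages of the clique and of the
  independent part. This yields surjectivity of the correspondence between pairs and copies.\<close>

lemma K_star_iso_star_graph:
  assumes H: "simple_graph H" and iso: "graph_iso H (K_star s t)"
  obtains S T where "finite S" "finite T" "card S = s" "card T = t" "S \<inter> T = {}"
    "H = star_graph S T"
proof -
  obtain f where f: "bij_betw f (verts H) {..<s + t}"
    and e: "\<And>u v. u \<in> verts H \<Longrightarrow> v \<in> verts H \<Longrightarrow>
        {u, v} \<in> edges H \<longleftrightarrow> {f u, f v} \<in> edges (K_star s t)"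
    using iso by (auto simp: graph_iso_def K_star_def)
  let ?S = "{u \<in> verts H. f u < s}" and ?T = "{u \<in> verts H. \<not> f u < s}"
  have fin: "finite ?S" "finite ?T" using H by (auto simp: simple_graph_def)
  have inj: "inj_on f (verts H)" and im: "f ` verts H = {..<s + t}"
    using f by (auto simp: bij_betw_def)
  have "f ` ?S = {..<s}"
  proof -
    have "f ` ?S = f ` verts H \<inter> {..<s}" by auto
    then show ?thesis unfolding im by auto
  qed
  moreover have "f ` ?T = {s..<s + t}"
  proof -
    have "f ` ?T = f ` verts H \<inter> {s..}" by auto
    then show ?thesis unfolding im by auto
  qed
  moreover have "card (f ` ?S) = card ?S" "card (f ` ?T) = card ?T"
    by (auto intro!: card_image inj_on_subset[OF inj])
  ultimately have c: "card ?S = s" "card ?T = t" by simp_all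
  have V: "verts H = ?S \<union> ?T" by auto
  have lt: "f u < s + t" if "u \<in> verts H" for u using that im by auto
  have iff: "{u, v} \<in> edges H \<longleftrightarrow> {u, v} \<in> edges (star_graph ?S ?T)"
    if "u \<in> verts H" "v \<in> verts H" for u v
    unfolding e[OF that] K_star_edge_iff star_graph_edge_iff
    using that lt inj by (auto simp: inj_on_eq_iff)
  have "edges H = edges (star_graph ?S ?T)"
  proof (rule set_eqI)
    fix e
    have "e \<in> edges H \<Longrightarrow> \<exists>u v. e = {u, v} \<and> u \<in> verts H \<and> v \<in> verts H"
      using H unfolding simple_graph_def by (metis card_2_iff insert_subset)
    moreover have "e \<in> edges (star_graph ?S ?T) \<Longrightarrow> \<exists>u v. e = {u, v} \<and> u \<in> verts H \<and> v \<in> verts H"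
      by (auto simp: star_graph_def)
    ultimately show "e \<in> edges H \<longleftrightarrow> e \<in> edges (star_graph ?S ?T)"
      using iff by blast
  qed
  with V have "H = star_graph ?S ?T" by (simp add: prod_eq_iff star_graph_def)
  with fin c show ?thesis by (intro that) auto
qed

text \<open>The bijection is \<open>star_graph\<close>. For \<open>t = 1\<close> it would not be
  injective: a complete graph on \<open>s + 1\<close> vertices comes from \<open>s + 1\<close>
  pairs.\<close>

lemma card_copies_K_star:
  assumes G: "simple_graph G" and st: "s \<ge> 1" "t \<ge> 2"
  shows "card (copies (K_star s t) G) = card (stars s t (edges G))"
proof -
  have "bij_betw (\<lambda>(S, T). star_graph S T) (stars s t (edges G)) (copies (K_star s t) G)"
    unfolding bij_betw_def
  proof
    show "inj_on (\<lambda>(S, T). star_graph S T) (stars s t (edges G))"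
    proof (rule inj_onI, clarify)
      fix S T S' T'
      assume "(S, T) \<in> stars s t (edges G)" "(S', T') \<in> stars s t (edges G)"
        and eq: "star_graph S T = star_graph S' T'"
      then have d: "S \<inter> T = {}" "S' \<inter> T' = {}" "card T \<ge> 2" "card T' \<ge> 2"
        using st by (auto simp: stars_def)
      have S: "S = S'"
        using star_graph_clique[OF d(1,3)] star_graph_clique[OF d(2,4)] eq by simp
      moreover have "S \<union> T = S' \<union> T'" using eq by (simp add: star_graph_def)
      ultimately show "S = S' \<and> T = T'" using d by blast
    qed
    show "(\<lambda>(S, T). star_graph S T) ` stars s t (edges G) = copies (K_star s t) G"
    proof (intro equalityI subsetI)
      fix H assume "H \<in> (\<lambda>(S, T). star_graph S T) ` stars s t (edges G)"
      then obtain S T where ST: "(S, T) \<in> stars s t (edges G)" "H = star_graph S T" by auto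
      then have "S \<subseteq> verts G" "T \<subseteq> verts G"
        using stars_subset[of "verts G" "edges G" s t] G st by auto
      then have "is_subgraph H G"
        using ST by (auto simp: is_subgraph_def simple_graph_star_graph stars_def)
          (auto simp: star_graph_def)
      moreover have "graph_iso H (K_star s t)"
        using ST star_graph_iso_K_star[of S T] by (auto simp: stars_def)
      ultimately show "H \<in> copies (K_star s t) G" by (auto simp: copies_def)
    next
      fix H assume "H \<in> copies (K_star s t) G"
      then have H: "is_subgraph H G" "simple_graph H" "graph_iso H (K_star s t)"
        by (auto simp: copies_def is_subgraph_def)
      then obtain S T where ST: "finite S" "finite T" "card S = s" "card T = t" "S \<inter> T = {}"
        "H = star_graph S T" by (metis K_star_iso_star_graph)
      have "{u, v} \<in> edges G" if "u \<in> S" "v \<in> S \<union> T" "u \<noteq> v" for u v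
      proof -
        have "{u, v} \<in> edges (star_graph S T)"
          using that unfolding star_graph_edge_iff by blast
        then show ?thesis using H(1) unfolding ST(6) is_subgraph_def by blast
      qed
      with ST have "(S, T) \<in> stars s t (edges G)" by (auto simp: stars_def)
      with ST(6) show "H \<in> (\<lambda>(S, T). star_graph S T) ` stars s t (edges G)" by force
    qed
  qed
  then show ?thesis by (simp add: bij_betw_same_card)
qed

section \<open>Shifting\<close>

text \<open>The compression operator of extremal set theory. An edge whose image is already occupied
  stays put, which keeps the map injective on \<open>E\<close>.\<close>

definition shift_edge :: "'a \<Rightarrow> 'a \<Rightarrow> 'a set set \<Rightarrow> 'a set \<Rightarrow> 'a set" where
  "shift_edge i j E e =
     (if j \<in> e \<and> i \<notin> e \<and> transpose i j ` e \<notin> E then transpose i j ` e else e)"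

definition shift :: "'a \<Rightarrow> 'a \<Rightarrow> 'a set set \<Rightarrow> 'a set set" where
  "shift i j E = shift_edge i j E ` E"

lemma transpose_image_transpose_image [simp]: "transpose i j ` transpose i j ` A = A"
  by (simp add: image_comp)

lemma mem_transpose_image_iff: "x \<in> transpose i j ` A \<longleftrightarrow> transpose i j x \<in> A"
  by (metis image_iff transpose_involutory)

lemma transpose_image_same:
  assumes "i \<in> A \<longleftrightarrow> j \<in> A"
  shows "transpose i j ` A = A"
  using assms by (auto simp: mem_transpose_image_iff transpose_def)

lemma transpose_image_eq:
  assumes "j \<in> A" "i \<notin> A"
  shows "transpose i j ` A = insert i (A - {j})"
  using assms by (auto simp: mem_transpose_image_iff transpose_def split: if_splits)

lemma shift_cases:
  assumes "e \<in> shift i j E" "e \<notin> E"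
  shows "i \<in> e \<and> j \<notin> e \<and> transpose i j ` e \<in> E"
proof -
  obtain d where d: "d \<in> E" "e = shift_edge i j E d"
    using assms(1) by (auto simp: shift_def)
  with assms(2) have "j \<in> d" "i \<notin> d" "e = transpose i j ` d"
    by (auto simp: shift_edge_def split: if_splits)
  with d(1) show ?thesis by (simp add: mem_transpose_image_iff)
qed

text \<open>Such an edge was not moved, and the only possible obstacle is that its image was an edge
  already.\<close>

lemma shift_mem_both:
  assumes "e \<in> shift i j E" "j \<in> e" "i \<notin> e"
  shows "e \<in> E \<and> transpose i j ` e \<in> E"
proof -
  obtain d where d: "d \<in> E" "e = shift_edge i j E d"
    using assms(1) by (auto simp: shift_def)
  with assms(2,3) have "e = d" "transpose i j ` e \<in> E"
    by (auto simp: shift_edge_def mem_transpose_image_iff split: if_splits)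
  with d(1) show ?thesis by simp
qed

lemma shift_keep:
  assumes "e \<in> E" "j \<notin> e \<or> i \<in> e \<or> transpose i j ` e \<in> E"
  shows "e \<in> shift i j E"
  unfolding shift_def by (rule image_eqI[of _ _ e]) (use assms in \<open>auto simp: shift_edge_def\<close>)

text \<open>If the image is already an edge, the shift keeps it because it does not contain
  \<open>j\<close>.\<close>

lemma shift_move:
  assumes "e \<in> E" "j \<in> e" "i \<notin> e"
  shows "transpose i j ` e \<in> shift i j E"
proof (cases "transpose i j ` e \<in> E")
  case True
  then show ?thesis using assms by (intro shift_keep) (auto simp: mem_transpose_image_iff)
next
  case False
  then show ?thesis unfolding shift_def
    by (intro image_eqI[of _ _ e]) (use assms in \<open>auto simp: shift_edge_def\<close>)
qed

text \<open>A moved edge lands outside \<open>E\<close>, so it never collides with a kept one; two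
  moved edges stay distinct because the transposition is an involution.\<close>

lemma inj_on_shift_edge: "inj_on (shift_edge i j E) E"
proof (rule inj_onI)
  fix d e assume "d \<in> E" "e \<in> E" and eq: "shift_edge i j E d = shift_edge i j E e"
  have "transpose i j ` d = transpose i j ` e \<Longrightarrow> d = e"
    by (metis transpose_image_transpose_image)
  with \<open>d \<in> E\<close> \<open>e \<in> E\<close> eq show "d = e"
    unfolding shift_edge_def by (metis (full_types))
qed

lemma simple_graph_shift:
  assumes "simple_graph (V, E)" "i \<in> V" "j \<in> V"
  shows "simple_graph (V, shift i j E)"
proof -
  have "transpose i j ` e \<subseteq> V" if "e \<subseteq> V" for e
    using that assms(2,3) by (auto simp: transpose_def)
  moreover have "card (transpose i j ` e) = card e" for e
    by (simp add: card_image)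
  ultimately have "shift_edge i j E e \<subseteq> V \<and> card (shift_edge i j E e) = 2" if "e \<in> E" for e
    using assms(1) that by (simp add: simple_graph_def shift_edge_def)
  then show ?thesis using assms(1) by (simp add: simple_graph_def shift_def)
qed

text \<open>A matching of the shifted graph contains at most one new edge, because new edges contain
  \<open>i\<close>; if it contains one, applying the transposition to the whole matching puts it into \<open>E\<close>.\<close>

lemma has_matching_shift:
  assumes "has_matching (shift i j E) m"
  shows "has_matching E m"
proof -
  obtain g where inj: "inj_on g {..<2 * m}"
    and g: "\<And>l. l < m \<Longrightarrow> {g (2 * l), g (2 * l + 1)} \<in> shift i j E"
    using assms by (auto simp: has_matching_def)
  show ?thesis
  proof (cases "\<forall>l<m. {g (2 * l), g (2 * l + 1)} \<in> E")
    case True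
    then show ?thesis using inj by (auto simp: has_matching_def)
  next
    case False
    then obtain p where p: "p < m" "{g (2 * p), g (2 * p + 1)} \<notin> E" by blast
    note sp = shift_cases[OF g[OF p(1)] p(2)]
    have "transpose i j ` {g (2 * l), g (2 * l + 1)} \<in> E" if l: "l < m" for l
    proof (cases "l = p")
      case True
      then show ?thesis using sp by simp
    next
      case False
      have "g x \<noteq> g y" if "x \<in> {2 * l, 2 * l + 1}" "y \<in> {2 * p, 2 * p + 1}" for x y
      proof -
        have "x \<noteq> y" using that False by auto
        moreover have "x < 2 * m" "y < 2 * m" using that l p by auto
        ultimately show ?thesis using inj by (auto simp: inj_on_eq_iff)
      qed
      then have "g x \<noteq> i" if "x \<in> {2 * l, 2 * l + 1}" for x
        using sp that by blast
      then have i: "i \<notin> {g (2 * l), g (2 * l + 1)}" by blast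
      then have E: "{g (2 * l), g (2 * l + 1)} \<in> E"
        using shift_cases[OF g[OF l]] by blast
      \<comment> \<open>An edge through \<open>j\<close> but not \<open>i\<close> survived only
        because its image is in \<open>E\<close>; an edge avoiding both is fixed by the
        transposition.\<close>
      show ?thesis
      proof (cases "j \<in> {g (2 * l), g (2 * l + 1)}")
        case True
        then show ?thesis using shift_mem_both[OF g[OF l] _ i] by blast
      next
        case False
        then show ?thesis using E i by (simp only: transpose_image_same)
      qed
    qed
    moreover have "inj_on (transpose i j \<circ> g) {..<2 * m}"
      using inj by (intro comp_inj_on) auto
    ultimately show ?thesis
      unfolding has_matching_def by (intro exI[of _ "transpose i j \<circ> g"]) simp
  qed
qed

text \<open>The injection keeps a pair that survives the shift and transposes the others. It works
  because neighbourhoods in \<open>K_star\<close> are nested.\<close>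

lemma stars_shift_lost:
  assumes P: "(S, T) \<in> stars s t E" and nP: "(S, T) \<notin> stars s t (shift i j E)"
  shows "(transpose i j ` S, transpose i j ` T) \<in> stars s t (shift i j E) - stars s t E"
proof -
  let ?\<sigma> = "transpose i j"
  have fin: "finite S" "finite T" "card S = s" "card T = t" "S \<inter> T = {}"
    and E: "\<And>u v. u \<in> S \<Longrightarrow> v \<in> S \<union> T \<Longrightarrow> u \<noteq> v \<Longrightarrow> {u, v} \<in> E"
    using P by (auto simp: stars_def)
  obtain u0 v0 where uv: "u0 \<in> S" "v0 \<in> S \<union> T" "u0 \<noteq> v0" "{u0, v0} \<notin> shift i j E"
    using nP fin by (auto simp: stars_def)
  have uvE: "{u0, v0} \<in> E" using E uv by blast
  have lost: "j \<in> {u0, v0}" "i \<notin> {u0, v0}" "?\<sigma> ` {u0, v0} \<notin> E"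
    using shift_keep[OF uvE, of j i] uv(4) by blast+
  \<comment> \<open>Only an edge through \<open>j\<close> whose image is a non-edge can be lost.
    Write it as \<open>{j, x}\<close>, so that \<open>{i, x}\<close> is the non-edge.\<close>
  obtain x where x: "{u0, v0} = {j, x}" "x \<noteq> i" "x \<noteq> j" using lost uv(3) by fastforce
  have jx: "j \<in> S \<union> T" "x \<in> S \<union> T" "j \<in> S \<or> x \<in> S"
    using uv(1,2) x(1) by (auto simp: doubleton_eq_iff)
  have ij: "i \<noteq> j" using lost by auto
  have ix: "{i, x} \<notin> E" using lost(3) x ij by (simp add: transpose_def insert_commute)
  \<comment> \<open>If \<open>i\<close> belongs to the copy, then the non-adjacent \<open>i\<close>
    and \<open>x\<close> both lie in \<open>T\<close>. Hence \<open>j\<close> is in the clique and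
    sees the whole copy.\<close>
  have dom: "{j, v} \<in> E" if "i \<in> S \<union> T" "v \<in> S \<union> T" "v \<noteq> j" for v
  proof -
    have "i \<notin> S" using ix E[of i x] jx(2) x(2) by blast
    moreover have "x \<notin> S" using ix E[of x i] that(1) x(2) by (auto simp: insert_commute)
    ultimately have "j \<in> S" using jx(3) by blast
    then show ?thesis using E that by blast
  qed
  have in': "?\<sigma> ` {u, v} \<in> shift i j E" if "u \<in> S" "v \<in> S \<union> T" "u \<noteq> v" for u v
  proof -
    have e: "{u, v} \<in> E" using E that by blast
    consider "i \<in> {u, v} \<longleftrightarrow> j \<in> {u, v}" | "j \<in> {u, v}" "i \<notin> {u, v}" | "i \<in> {u, v}" "j \<notin> {u, v}"
      by blast
    then show ?thesis
    proof cases
      case 1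
      then show ?thesis using e by (simp only: transpose_image_same) (auto intro: shift_keep)
    next
      case 2
      then show ?thesis using e by (rule shift_move[rotated])
    next
      \<comment> \<open>The image \<open>{j, y}\<close> is an edge by \<open>dom\<close>, and the
        shift keeps it because its own image \<open>{i, y}\<close> is an edge too.\<close>
      case 3
      then obtain y where y: "{u, v} = {i, y}" "y \<noteq> i" "y \<noteq> j" using \<open>u \<noteq> v\<close> by fastforce
      then have "{j, y} \<in> E"
        using dom that by (auto simp: doubleton_eq_iff)
      moreover have "?\<sigma> ` {u, v} = {j, y}" using y by (simp add: transpose_def insert_commute)
      ultimately show ?thesis using e shift_keep[of "{j, y}" E j i]
        by (metis transpose_image_transpose_image)
    qed
  qed
  have "{u, v} \<in> shift i j E" if uv': "u \<in> ?\<sigma> ` S" "v \<in> ?\<sigma> ` S \<union> ?\<sigma> ` T" "u \<noteq> v" for u v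
  proof -
    obtain p q where "p \<in> S" "q \<in> S \<union> T" "u = ?\<sigma> p" "v = ?\<sigma> q" using uv' by blast
    with in'[of p q] uv'(3) show ?thesis by auto
  qed
  moreover have "?\<sigma> ` S \<inter> ?\<sigma> ` T = {}"
    using fin(5) by (simp flip: image_Int[OF inj_transpose])
  ultimately have "(?\<sigma> ` S, ?\<sigma> ` T) \<in> stars s t (shift i j E)"
    using fin(1-4) by (simp add: stars_def card_image)
  \<comment> \<open>The transposed pair would need the edge \<open>{i, x}\<close>, the image of the
    lost one.\<close>
  moreover have "(?\<sigma> ` S, ?\<sigma> ` T) \<notin> stars s t E"
  proof
    assume "(?\<sigma> ` S, ?\<sigma> ` T) \<in> stars s t E"
    then have "\<forall>u\<in>?\<sigma> ` S. \<forall>v\<in>?\<sigma> ` S \<union> ?\<sigma> ` T. u \<noteq> v \<longrightarrow> {u, v} \<in> E"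
      by (simp add: stars_def)
    moreover have "?\<sigma> u0 \<in> ?\<sigma> ` S" "?\<sigma> v0 \<in> ?\<sigma> ` S \<union> ?\<sigma> ` T" "?\<sigma> u0 \<noteq> ?\<sigma> v0"
      using uv(1-3) by (auto dest: injD[OF inj_transpose])
    ultimately have "{?\<sigma> u0, ?\<sigma> v0} \<in> E" by blast
    then show False using lost(3) by simp
  qed
  ultimately show ?thesis by blast
qed

lemma card_stars_shift:
  assumes "finite (stars s t (shift i j E))"
  shows "card (stars s t E) \<le> card (stars s t (shift i j E))"
proof (rule card_inj_on_le[OF _ _ assms])
  let ?\<tau> = "map_prod (image (transpose i j)) (image (transpose i j))"
  let ?\<phi> = "\<lambda>P. if P \<in> stars s t (shift i j E) then P else ?\<tau> P"
  have lost: "?\<tau> P \<in> stars s t (shift i j E) - stars s t E"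
    if "P \<in> stars s t E" "P \<notin> stars s t (shift i j E)" for P
    using that stars_shift_lost by (cases P) (simp only: map_prod_simp)
  have \<tau>\<tau>: "?\<tau> (?\<tau> P) = P" for P by (cases P) simp
  \<comment> \<open>Kept pairs lie in \<open>stars s t E\<close> and transposed ones do not, so the
    two kinds never collide.\<close>
  show "inj_on ?\<phi> (stars s t E)"
  proof (rule inj_onI)
    fix P Q assume P: "P \<in> stars s t E" and Q: "Q \<in> stars s t E" and eq: "?\<phi> P = ?\<phi> Q"
    show "P = Q" using lost[OF P] lost[OF Q] P Q eq \<tau>\<tau>[of P] \<tau>\<tau>[of Q]
      by (metis Diff_iff)
  qed
  show "?\<phi> ` stars s t E \<subseteq> stars s t (shift i j E)"
    using lost by auto
qed

text \<open>For a simple graph this means being fixed by \<open>shift i j\<close> whenever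
  \<open>i < j\<close>.\<close>

definition stable :: "nat set set \<Rightarrow> bool" where
  "stable E \<longleftrightarrow> (\<forall>i j x. i < j \<and> {j, x} \<in> E \<and> x \<noteq> i \<longrightarrow> {i, x} \<in> E)"

lemma stableD: "stable E \<Longrightarrow> {j, x} \<in> E \<Longrightarrow> i < j \<Longrightarrow> x \<noteq> i \<Longrightarrow> {i, x} \<in> E"
  by (auto simp: stable_def)

text \<open>The sum of the labels over all edges is the termination measure: each moved edge trades
  \<open>j\<close> for the smaller \<open>i\<close>, and the violation of stability guarantees that
  \<open>{j, x}\<close> moves.\<close>

lemma sum_shift_less:
  fixes E :: "nat set set"
  assumes G: "simple_graph ({..<n}, E)" and "i < j" "{j, x} \<in> E" "x \<noteq> i" "{i, x} \<notin> E"
  shows "sum \<Sum> (shift i j E) < sum \<Sum> E"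
proof -
  have "E \<subseteq> Pow {..<n}" using G by (auto simp: simple_graph_def)
  then have finE: "finite E" and fe: "\<And>e. e \<in> E \<Longrightarrow> finite e"
    by (auto intro: finite_subset)
  have move: "\<Sum>(transpose i j ` e) < \<Sum>e" if "e \<in> E" "j \<in> e" "i \<notin> e" for e
    using that assms(2) fe by (simp add: transpose_image_eq sum.remove)
  have "card {j, x} = 2" using G assms(3) by (auto simp: simple_graph_def)
  then have xj: "x \<noteq> j" by auto
  have "sum \<Sum> (shift i j E) = (\<Sum>e\<in>E. \<Sum>(shift_edge i j E e))"
    unfolding shift_def by (simp add: sum.reindex[OF inj_on_shift_edge] o_def)
  also have "\<dots> < sum \<Sum> E"
  proof (rule sum_strict_mono_ex1[OF finE])
    show "\<forall>e\<in>E. \<Sum>(shift_edge i j E e) \<le> \<Sum>e"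
      using move by (auto simp: shift_edge_def less_imp_le)
    have "transpose i j ` {j, x} = {i, x}" using xj assms by (simp add: transpose_def insert_commute)
    then have "shift_edge i j E {j, x} = transpose i j ` {j, x}"
      using assms by (auto simp: shift_edge_def)
    then show "\<exists>e\<in>E. \<Sum>(shift_edge i j E e) < \<Sum>e"
      using move[OF assms(3)] assms by (intro bexI[of _ "{j, x}"]) auto
  qed
  finally show ?thesis .
qed

text \<open>Shift along violations of stability until none is left; \<open>sum_shift_less\<close>
  makes this stop.\<close>

lemma exists_stable:
  assumes "simple_graph ({..<n}, E)" "\<not> has_matching E m" "s \<ge> 1" "t \<ge> 1"
  shows "\<exists>E'. simple_graph ({..<n}, E') \<and> \<not> has_matching E' m \<and> stable E' \<and>
    card (stars s t E) \<le> card (stars s t E')"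
  using assms(1,2)
proof (induction "sum \<Sum> E" arbitrary: E rule: less_induct)
  case less
  show ?case
  proof (cases "stable E")
    case True
    then show ?thesis using less.prems by blast
  next
    case False
    then obtain i j x where ij: "i < j" "{j, x} \<in> E" "x \<noteq> i" "{i, x} \<notin> E"
      by (auto simp: stable_def)
    then have "j < n" using less.prems(1) by (auto simp: simple_graph_def)
    then have G: "simple_graph ({..<n}, shift i j E)"
      using ij(1) by (intro simple_graph_shift less.prems) auto
    have le: "card (stars s t E) \<le> card (stars s t (shift i j E))"
      by (rule card_stars_shift[OF finite_stars[OF G assms(3,4)]])
    have "\<not> has_matching (shift i j E) m"
      using has_matching_shift[of i j E m] less.prems(2) by blast
    from less.hyps[OF sum_shift_less[OF less.prems(1) ij] G this] le
    show ?thesis by (meson order_trans)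
  qed
qed

section \<open>The host graphs\<close>

text \<open>The join of a clique on \<open>{..<a}\<close> with the disjoint union of a clique on \<open>{a..<b}\<close> and the
  isolated vertices \<open>{b..<n}\<close>.\<close>

definition host :: "nat \<Rightarrow> nat \<Rightarrow> nat \<Rightarrow> nat set set" where
  "host n a b = {{u, v} |u v. u < n \<and> v < n \<and> u \<noteq> v \<and> (u < a \<or> u < b \<and> v < b)}"

lemma host_edge_iff:
  "{u, v} \<in> host n a b \<longleftrightarrow>
     u < n \<and> v < n \<and> u \<noteq> v \<and> (u < a \<or> v < a \<or> u < b \<and> v < b)"
  by (auto simp: host_def doubleton_eq_iff)

lemma simple_graph_host: "simple_graph ({..<n}, host n a b)"
  by (auto simp: simple_graph_def host_def)

lemma stable_subset_host:
  assumes G: "simple_graph ({..<n}, E)" and st: "stable E" and nm: "\<not> has_matching E (k + 1)"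
  shows "\<exists>a\<le>k. E \<subseteq> host n a (2 * k + 1 - a)"
proof -
  \<comment> \<open>Positions \<open>2 * p\<close> and \<open>2 * p + 1\<close> carry the pair
    \<open>p\<close>, \<open>2 * k + 1 - p\<close>.\<close>
  let ?g = "\<lambda>x. if even x then x div 2 else 2 * k + 1 - x div 2"
  have "inj_on ?g {..<2 * (k + 1)}"
  proof (rule inj_onI)
    fix x y assume "x \<in> {..<2 * (k + 1)}" "y \<in> {..<2 * (k + 1)}" and eq: "?g x = ?g y"
    then obtain p q where "p < k + 1" "x = 2 * p \<or> x = 2 * p + 1"
      "q < k + 1" "y = 2 * q \<or> y = 2 * q + 1"
      by (metis lessThan_iff less_double_cases)
    with eq show "x = y" by auto
  qed
  then have "\<exists>i<k + 1. {?g (2 * i), ?g (2 * i + 1)} \<notin> E"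
    using nm unfolding has_matching_def by blast
  then obtain a where "a < k + 1" "{?g (2 * a), ?g (2 * a + 1)} \<notin> E"
    by blast
  then have a: "a \<le> k" "{a, 2 * k + 1 - a} \<notin> E"
    by simp_all
  \<comment> \<open>Lowering \<open>x\<close> to \<open>a\<close> and then \<open>y\<close> to
    \<open>2 * k + 1 - a\<close> would produce the missing edge. So each edge has its smaller end
    below \<open>a\<close> or its larger end below \<open>2 * k + 1 - a\<close>.\<close>
  have not_ge: False if "{x, y} \<in> E" "x < y" "a \<le> x" "2 * k + 1 - a \<le> y" for x y
  proof -
    have "{a, y} \<in> E"
      using that a(1) stableD[OF st that(1), of a] by (cases "a = x") auto
    then have "{y, a} \<in> E" by (simp only: insert_commute)
    then have "{2 * k + 1 - a, a} \<in> E"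
      using that(4) a(1) stableD[OF st, of y a "2 * k + 1 - a"]
      by (cases "2 * k + 1 - a = y") auto
    then show False using a(2) by (simp only: insert_commute)
  qed
  have "e \<in> host n a (2 * k + 1 - a)" if "e \<in> E" for e
  proof -
    have "card e = 2" "e \<subseteq> {..<n}" using G that by (auto simp: simple_graph_def)
    then obtain x y where xy: "e = {x, y}" "x \<noteq> y" "x < n" "y < n"
      by (auto simp: card_2_iff)
    then show ?thesis
      using not_ge[of x y] not_ge[of y x] \<open>e \<in> E\<close> insert_commute[of x y "{}"]
      unfolding host_edge_iff xy(1) by (metis not_le nat_neq_iff order.strict_trans)
  qed
  then show ?thesis using a(1) by blast
qed

lemma sum_pairs: "(\<Sum>x<2 * m. f x) = (\<Sum>i<m. f (2 * i) + f (2 * i + 1))"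
  for f :: "nat \<Rightarrow> 'a::comm_monoid_add"
  by (induction m) (simp_all add: add.assoc)

text \<open>Give weight 2 to the vertices below \<open>a\<close>, 1 to the next ones below \<open>b\<close>, and 0 to the
  others. Every edge has weight at least 2, while the total weight is \<open>a + b\<close>.\<close>

lemma host_no_matching:
  assumes "a \<le> b" "a + b < 2 * m"
  shows "\<not> has_matching (host n a b) m"
proof
  assume "has_matching (host n a b) m"
  then obtain g where g: "inj_on g {..<2 * m}"
    and gE: "\<And>i. i < m \<Longrightarrow> {g (2 * i), g (2 * i + 1)} \<in> host n a b"
    by (auto simp: has_matching_def)
  define w :: "nat \<Rightarrow> nat" where "w x = of_bool (x < a) + of_bool (x < b)" for x
  have "2 * m = (\<Sum>i<m. 2)" by simp
  also have "\<dots> \<le> (\<Sum>i<m. w (g (2 * i)) + w (g (2 * i + 1)))"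
    using gE assms(1) by (intro sum_mono) (fastforce simp: host_edge_iff w_def)
  also have "\<dots> = (\<Sum>x<2 * m. w (g x))" by (rule sum_pairs[symmetric])
  also have "\<dots> = sum w (g ` {..<2 * m})" by (simp add: sum.reindex[OF g])
  also have "\<dots> = card (g ` {..<2 * m} \<inter> {..<a}) + card (g ` {..<2 * m} \<inter> {..<b})"
    by (simp add: w_def sum.distrib Int_def)
  also have "\<dots> \<le> card {..<a} + card {..<b}"
    by (intro add_mono card_mono) auto
  finally show False using assms(2) by simp
qed

section \<open>Counting the pairs in a host graph\<close>

lemma card_Sigma_subsets:
  assumes "finite A" "finite B" "\<S> \<subseteq> {S. S \<subseteq> B \<and> card S = s}" "B \<subseteq> A"
  shows "card (Sigma \<S> (\<lambda>S. {T. T \<subseteq> A - S \<and> card T = t})) = card \<S> * ((card A - s) choose t)"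
proof -
  have "finite \<S>" by (rule finite_subset[of _ "Pow B"]) (use assms in auto)
  moreover have "card {T. T \<subseteq> A - S \<and> card T = t} = (card A - s) choose t" if "S \<in> \<S>" for S
  proof -
    have "S \<subseteq> A" "card S = s" using that assms(3,4) by blast+
    then show ?thesis
      using assms(1) by (simp add: n_subsets card_Diff_subset finite_subset)
  qed
  ultimately show ?thesis
    using assms(1) by (subst card_SigmaI) auto
qed

text \<open>The split is by how far \<open>S\<close> reaches. A clique vertex in
  \<open>{a..<b}\<close> has all its neighbours below \<open>b\<close>, and one in
  \<open>{b..<n}\<close> has all its neighbours below \<open>a\<close>; this confines the rest of
  the pair.\<close>

lemma stars_host:
  assumes "a \<le> b" "b \<le> n" "s \<ge> 1" "t \<ge> 1"
  shows "stars s t (host n a b) =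
    Sigma {S. S \<subseteq> {..<a} \<and> card S = s} (\<lambda>S. {T. T \<subseteq> {..<n} - S \<and> card T = t}) \<union>
    Sigma ({S. S \<subseteq> {..<b} \<and> card S = s} - {S. S \<subseteq> {..<a} \<and> card S = s})
      (\<lambda>S. {T. T \<subseteq> {..<b} - S \<and> card T = t}) \<union>
    (\<lambda>(v, S, T). (insert v S, T)) ` ({b..<n} \<times>
      Sigma {S. S \<subseteq> {..<a} \<and> card S = s - 1} (\<lambda>S. {T. T \<subseteq> {..<a} - S \<and> card T = t}))"
    (is "_ = ?X1 \<union> ?X2 \<union> ?X3")
proof (intro equalityI subsetI)
  fix P assume "P \<in> stars s t (host n a b)"
  moreover obtain S T where P: "P = (S, T)" by (cases P)
  ultimately have ST: "(S, T) \<in> stars s t (host n a b)" by simp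
  then have fin: "finite S" "finite T" "card S = s" "card T = t" "S \<inter> T = {}"
    and E: "\<And>u v. u \<in> S \<Longrightarrow> v \<in> S \<union> T \<Longrightarrow> u \<noteq> v \<Longrightarrow> {u, v} \<in> host n a b"
    by (auto simp: stars_def)
  have sub: "S \<subseteq> {..<n}" "T \<subseteq> {..<n}"
    using stars_subset[OF simple_graph_host assms(3,4)] ST by blast+
  consider "S \<subseteq> {..<a}" | "\<not> S \<subseteq> {..<a}" "S \<subseteq> {..<b}" | v where "v \<in> S" "b \<le> v"
    by (meson lessThan_iff not_less subsetI)
  then show "P \<in> ?X1 \<union> ?X2 \<union> ?X3"
  proof cases
    case 1
    then have "P \<in> ?X1" using fin sub by (auto simp: P)
    then show ?thesis by blast
  next
    case 2
    then obtain u where u: "u \<in> S" "a \<le> u" by (meson lessThan_iff not_less subsetI)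
    have "v < b" if "v \<in> T" for v
      using E[of u v] u that fin(5) assms by (cases "u = v") (auto simp: host_edge_iff)
    then have "P \<in> ?X2" using 2 fin by (auto simp: P)
    then show ?thesis by blast
  next
    case 3
    have "y < a" if "y \<in> S \<union> T" "y \<noteq> v" for y
      using E[of v y] that 3 assms by (auto simp: host_edge_iff)
    moreover have "v \<notin> T" using fin 3 by blast
    moreover have "card (S - {v}) = s - 1" using fin 3 by simp
    ultimately have "(v, S - {v}, T) \<in> {b..<n} \<times>
      Sigma {S. S \<subseteq> {..<a} \<and> card S = s - 1} (\<lambda>S. {T. T \<subseteq> {..<a} - S \<and> card T = t})"
      using 3 sub fin by auto
    moreover have "P = (\<lambda>(v, S, T). (insert v S, T)) (v, S - {v}, T)"
      using 3 by (auto simp: P)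
    ultimately show ?thesis by blast
  qed
next
  fix P assume "P \<in> ?X1 \<union> ?X2 \<union> ?X3"
  then consider "P \<in> ?X1" | "P \<in> ?X2" | "P \<in> ?X3" by blast
  then show "P \<in> stars s t (host n a b)"
  proof cases
    case 1
    then obtain S T where P: "P = (S, T)" "S \<subseteq> {..<a}" "T \<subseteq> {..<n} - S" "card S = s" "card T = t"
      by auto
    moreover have "finite S" "finite T" using P by (auto intro: finite_subset)
    moreover have "S \<subseteq> {..<n}" using P assms by auto
    ultimately show ?thesis
      by (auto simp: stars_def host_edge_iff subset_iff)
  next
    case 2
    then obtain S T where P: "P = (S, T)" "S \<subseteq> {..<b}" "T \<subseteq> {..<b} - S" "card S = s" "card T = t"
      by auto
    moreover have "finite S" "finite T" using P by (auto intro: finite_subset)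
    moreover have "x < n" if "x < b" for x using that assms by simp
    ultimately show ?thesis
      by (auto simp: stars_def host_edge_iff subset_iff)
  next
    case 3
    then obtain v S T where P: "P = (insert v S, T)" "b \<le> v" "v < n" "S \<subseteq> {..<a}"
      "T \<subseteq> {..<a} - S" "card S = s - 1" "card T = t"
      by auto
    have fin: "finite S" "finite T" using P by (auto intro: finite_subset)
    have v: "v \<notin> S" "v \<notin> T" using P assms by auto
    have "card (insert v S) = s" using fin v P assms by simp
    moreover have "{u, w} \<in> host n a b" if "u \<in> insert v S" "w \<in> insert v S \<union> T" "u \<noteq> w" for u w
    proof -
      have "u = v \<or> u < a" "w = v \<or> w < a" using that P(4,5) by auto
      then show ?thesis using that(3) P(2,3) assms(1,2) unfolding host_edge_iff by auto
    qed
    moreover have "insert v S \<inter> T = {}" using P(5) v by auto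
    ultimately show ?thesis
      using P(1,7) fin by (simp add: stars_def)
  qed
qed

text \<open>The summands count the pairs \<open>(S, T)\<close> with \<open>S \<subseteq> {..<a}\<close>, those within \<open>{..<b}\<close> with
  \<open>S\<close> not contained in \<open>{..<a}\<close>, and those with a vertex of \<open>S\<close> in \<open>{b..<n}\<close>.\<close>

definition host_count :: "nat \<Rightarrow> nat \<Rightarrow> nat \<Rightarrow> nat \<Rightarrow> nat \<Rightarrow> nat" where
  "host_count s t n a b = (a choose s) * ((n - s) choose t) +
     ((b choose s) - (a choose s)) * ((b - s) choose t) +
     (n - b) * ((a choose (s - 1)) * ((a - (s - 1)) choose t))"

lemma card_stars_host:
  assumes "a \<le> b" "b \<le> n" "s \<ge> 1" "t \<ge> 1"
  shows "card (stars s t (host n a b)) = host_count s t n a b"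
proof -
  let ?X1 = "Sigma {S. S \<subseteq> {..<a} \<and> card S = s} (\<lambda>S. {T. T \<subseteq> {..<n} - S \<and> card T = t})"
  let ?\<S> = "{S. S \<subseteq> {..<b} \<and> card S = s} - {S. S \<subseteq> {..<a} \<and> card S = s}"
  let ?X2 = "Sigma ?\<S> (\<lambda>S. {T. T \<subseteq> {..<b} - S \<and> card T = t})"
  let ?f = "\<lambda>(v, S, T). (insert v S, T)"
  let ?Y = "Sigma {S. S \<subseteq> {..<a} \<and> card S = s - 1} (\<lambda>S. {T. T \<subseteq> {..<a} - S \<and> card T = t})"
  have fin: "finite (?X1 \<union> ?X2 \<union> ?f ` ({b..<n} \<times> ?Y))"
    unfolding stars_host[OF assms, symmetric] by (rule finite_stars[OF simple_graph_host assms(3,4)])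
  have d1: "?X1 \<inter> ?X2 = {}" by auto
  have d2: "(?X1 \<union> ?X2) \<inter> ?f ` ({b..<n} \<times> ?Y) = {}" using assms(1) by auto
  have c1: "card ?X1 = (a choose s) * ((n - s) choose t)"
    using card_Sigma_subsets[of "{..<n}" "{..<a}" "{S. S \<subseteq> {..<a} \<and> card S = s}" s t] assms
    by (simp add: n_subsets)
  have "card ?\<S> = (b choose s) - (a choose s)"
  proof -
    have "finite {S. S \<subseteq> {..<a} \<and> card S = s}"
      by (rule finite_subset[of _ "Pow {..<a}"]) auto
    then show ?thesis
      using assms by (subst card_Diff_subset) (auto simp: n_subsets)
  qed
  then have c2: "card ?X2 = ((b choose s) - (a choose s)) * ((b - s) choose t)"
    using card_Sigma_subsets[of "{..<b}" "{..<b}" ?\<S> s t] by auto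
  \<comment> \<open>The vertex \<open>v\<close> is recovered as the only element of
    \<open>insert v S\<close> that is not below \<open>a\<close>.\<close>
  have "inj_on ?f ({b..<n} \<times> ?Y)"
  proof (rule inj_onI, clarsimp)
    fix v S T v' S'
    assume *: "b \<le> v" "b \<le> v'" "S \<subseteq> {..<a}" "S' \<subseteq> {..<a}" "insert v S = insert v' S'"
    then have "v \<notin> S" "v' \<notin> S'" "v \<notin> S'" "v' \<notin> S" using assms(1) by auto
    then show "v = v' \<and> S = S'" using *(5) by (metis insertE insert_ident insertI1)
  qed
  then have c3: "card (?f ` ({b..<n} \<times> ?Y)) = (n - b) * ((a choose (s - 1)) * ((a - (s - 1)) choose t))"
    using card_Sigma_subsets[of "{..<a}" "{..<a}" "{S. S \<subseteq> {..<a} \<and> card S = s - 1}" "s - 1" t]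
    by (simp add: card_image card_cartesian_product n_subsets)
  show ?thesis
    unfolding stars_host[OF assms] host_count_def
    using fin by (simp only: card_Un_disjoint[OF _ _ d2] card_Un_disjoint[OF _ _ d1] finite_Un c1 c2 c3)
qed

section \<open>Convexity\<close>

text \<open>Discrete convexity on \<open>{0..k}\<close>, with integer values so that differences are
  not truncated.\<close>

definition convex_upto :: "nat \<Rightarrow> (nat \<Rightarrow> int) \<Rightarrow> bool" where
  "convex_upto k f \<longleftrightarrow> (\<forall>x. x + 2 \<le> k \<longrightarrow> 2 * f (x + 1) \<le> f x + f (x + 2))"

lemma convex_upto_cong:
  "convex_upto k f \<Longrightarrow> (\<And>a. a \<le> k \<Longrightarrow> g a = f a) \<Longrightarrow> convex_upto k g"
  by (simp add: convex_upto_def)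

lemma convex_upto_add:
  "convex_upto k f \<Longrightarrow> convex_upto k g \<Longrightarrow> convex_upto k (\<lambda>x. f x + g x)"
  by (fastforce simp: convex_upto_def)

text \<open>A discrete Leibniz rule: the difference of the two sides is the sum of
  \<open>f1 * (g0 + g2 - 2 * g1)\<close>, \<open>g1 * (f0 + f2 - 2 * f1)\<close> and the two
  products of first differences. These products are nonnegative when both factors are monotone in
  the same direction.\<close>

lemma convex_step:
  fixes f0 f1 f2 g0 g1 g2 :: int
  assumes "2 * f1 \<le> f0 + f2" "2 * g1 \<le> g0 + g2" "0 \<le> f1" "0 \<le> g1"
    "0 \<le> (f0 - f1) * (g0 - g1)" "0 \<le> (f1 - f2) * (g1 - g2)"
  shows "2 * (f1 * g1) \<le> f0 * g0 + f2 * g2"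
proof -
  have "0 \<le> f1 * (g0 + g2 - 2 * g1)" "0 \<le> g1 * (f0 + f2 - 2 * f1)"
    using assms by simp_all
  with assms(5,6) show ?thesis by (simp add: algebra_simps)
qed

lemma convex_upto_mult_mono:
  assumes "convex_upto k f" "convex_upto k g" "\<And>x. x \<le> k \<Longrightarrow> 0 \<le> f x" "\<And>x. x \<le> k \<Longrightarrow> 0 \<le> g x"
    "\<And>x. x + 1 \<le> k \<Longrightarrow> f x \<le> f (x + 1)" "\<And>x. x + 1 \<le> k \<Longrightarrow> g x \<le> g (x + 1)"
  shows "convex_upto k (\<lambda>x. f x * g x)"
  unfolding convex_upto_def
proof (intro allI impI convex_step)
  fix x assume "x + 2 \<le> k"
  then show "2 * f (x + 1) \<le> f x + f (x + 2)" "2 * g (x + 1) \<le> g x + g (x + 2)"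
    "0 \<le> f (x + 1)" "0 \<le> g (x + 1)"
    "0 \<le> (f x - f (x + 1)) * (g x - g (x + 1))"
    "0 \<le> (f (x + 1) - f (x + 2)) * (g (x + 1) - g (x + 2))"
    using assms(1-4) assms(5,6)[of x] assms(5,6)[of "x + 1"]
    by (auto simp: convex_upto_def intro: mult_nonpos_nonpos)
qed

lemma convex_upto_mult_antimono:
  assumes "convex_upto k f" "convex_upto k g" "\<And>x. x \<le> k \<Longrightarrow> 0 \<le> f x" "\<And>x. x \<le> k \<Longrightarrow> 0 \<le> g x"
    "\<And>x. x + 1 \<le> k \<Longrightarrow> f (x + 1) \<le> f x" "\<And>x. x + 1 \<le> k \<Longrightarrow> g (x + 1) \<le> g x"
  shows "convex_upto k (\<lambda>x. f x * g x)"
  unfolding convex_upto_def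
proof (intro allI impI convex_step)
  fix x assume "x + 2 \<le> k"
  then show "2 * f (x + 1) \<le> f x + f (x + 2)" "2 * g (x + 1) \<le> g x + g (x + 2)"
    "0 \<le> f (x + 1)" "0 \<le> g (x + 1)"
    "0 \<le> (f x - f (x + 1)) * (g x - g (x + 1))"
    "0 \<le> (f (x + 1) - f (x + 2)) * (g (x + 1) - g (x + 2))"
    using assms(1-4) assms(5,6)[of x] assms(5,6)[of "x + 1"]
    by (auto simp: convex_upto_def)
qed

lemma convex_upto_le_max:
  assumes "convex_upto k f" "a \<le> k"
  shows "f a \<le> max (f 0) (f k)"
  using assms
proof (induction k arbitrary: a)
  case 0
  then show ?case by simp
next
  case (Suc k)
  have k: "convex_upto k f" using Suc.prems(1) by (auto simp: convex_upto_def)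
  show ?case
  proof (cases "k = 0 \<or> a = Suc k")
    case True
    then show ?thesis using Suc.prems(2) by (auto simp: le_Suc_eq)
  next
    case False
    then have a: "a \<le> k" using Suc.prems(2) by simp
    obtain l where l: "k = Suc l" using False by (cases k) auto
    have "2 * f (Suc l) \<le> f l + f (Suc (Suc l))"
      using Suc.prems(1) l by (auto simp: convex_upto_def)
    moreover have "f l \<le> max (f 0) (f k)" using Suc.IH[OF k, of l] l by simp
    \<comment> \<open>If \<open>f k > f 0\<close>, then \<open>f l \<le> f k\<close>, and convexity
      at \<open>k\<close> forces \<open>f k \<le> f (Suc k)\<close>.\<close>
    ultimately have "f k \<le> max (f 0) (f (Suc k))" using l by (auto simp: max_def split: if_splits)
    moreover have "f a \<le> max (f 0) (f k)" using Suc.IH[OF k a] .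
    ultimately show ?thesis by auto
  qed
qed

section \<open>Second differences of binomial coefficients\<close>

definition second_diff :: "(nat \<Rightarrow> int) \<Rightarrow> nat \<Rightarrow> int" where
  "second_diff f x = f x + f (Suc (Suc x)) - 2 * f (Suc x)"

lemma convex_upto_iff: "convex_upto k f \<longleftrightarrow> (\<forall>x. x + 2 \<le> k \<longrightarrow> 0 \<le> second_diff f x)"
  by (simp add: convex_upto_def second_diff_def)

lemma second_diff_reflect:
  assumes "x + 2 \<le> m"
  shows "second_diff (\<lambda>a. f (m - a)) x = second_diff f (m - (x + 2))"
proof -
  have "m - x = Suc (Suc (m - (x + 2)))" "m - Suc x = Suc (m - (x + 2))"
    using assms by simp_all
  then show ?thesis by (simp add: second_diff_def)
qed

text \<open>Pascal's rule applied twice. The cases \<open>m = 0\<close> and \<open>m = 1\<close> are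
  constant and linear, and are separated because \<open>m - 2\<close> truncates.\<close>

lemma second_diff_choose:
  "second_diff (\<lambda>a. int (a choose m)) x = (if m \<ge> 2 then int (x choose (m - 2)) else 0)"
proof (cases m)
  case (Suc m')
  then show ?thesis by (cases m') (auto simp: second_diff_def)
qed (simp add: second_diff_def)

text \<open>For \<open>x < s\<close> truncation turns the values at \<open>x\<close> and
  \<open>x + 1\<close> into \<open>0 choose t = 0\<close>; otherwise this is a translate of
  \<open>second_diff_choose\<close>.\<close>

lemma second_diff_choose_diff_nonneg:
  assumes "t \<ge> 1"
  shows "0 \<le> second_diff (\<lambda>a. int ((a - s) choose t)) x"
proof (cases "s \<le> x")
  case True
  then have "second_diff (\<lambda>a. int ((a - s) choose t)) x = second_diff (\<lambda>a. int (a choose t)) (x - s)"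
    by (simp add: second_diff_def Suc_diff_le)
  then show ?thesis by (simp add: second_diff_choose)
next
  case False
  then show ?thesis using assms by (simp add: second_diff_def binomial_eq_0)
qed

text \<open>Both sides count disjoint pairs of an \<open>m\<close>-set and a \<open>t\<close>-set;
  the right side chooses their union first.\<close>

lemma choose_mult_choose_diff:
  "(a choose m) * ((a - m) choose t) = (a choose (m + t)) * ((m + t) choose t)"
proof (cases "m + t \<le> a")
  case True
  then show ?thesis
    using choose_mult[of m "m + t" a] binomial_symmetric[of m "m + t"] by simp
next
  case False
  then show ?thesis by (cases "m \<le> a") (auto simp: binomial_eq_0)
qed

text \<open>Each summand is a product of nonnegative convex functions of \<open>a\<close> with a
  common direction: nondecreasing in the first and third, nonincreasing in the second.\<close>

lemma convex_upto_host_count: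
  assumes "n \<ge> 2 * k + 1" "s \<ge> 1" "t \<ge> 1"
  shows "convex_upto k (\<lambda>a. int (host_count s t n a (2 * k + 1 - a)))"
proof -
  let ?m = "2 * k + 1"
  have 1: "convex_upto k (\<lambda>a. int (a choose s) * int ((n - s) choose t))"
    by (rule convex_upto_mult_mono)
      (auto simp: convex_upto_iff second_diff_choose binomial_right_mono simp: second_diff_def)
  have 2: "convex_upto k (\<lambda>a. (int ((?m - a) choose s) - int (a choose s)) * int ((?m - a - s) choose t))"
  proof (rule convex_upto_mult_antimono)
    show "convex_upto k (\<lambda>a. int ((?m - a) choose s) - int (a choose s))"
      unfolding convex_upto_iff
    proof (intro allI impI)
      fix x assume x: "x + 2 \<le> k"
      have "second_diff (\<lambda>a. int ((?m - a) choose s) - int (a choose s)) x =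
          second_diff (\<lambda>a. int ((?m - a) choose s)) x - second_diff (\<lambda>a. int (a choose s)) x"
        by (simp add: second_diff_def)
      also have "second_diff (\<lambda>a. int ((?m - a) choose s)) x =
          second_diff (\<lambda>a. int (a choose s)) (?m - (x + 2))"
        using x by (intro second_diff_reflect) simp
      \<comment> \<open>Both second differences are binomials with lower index \<open>s - 2\<close>,
        or both vanish, and the reflected point \<open>?m - (x + 2)\<close> is at least
        \<open>x\<close>.\<close>
      finally show "0 \<le> second_diff (\<lambda>a. int ((?m - a) choose s) - int (a choose s)) x"
        using x binomial_right_mono[of x "?m - (x + 2)" "s - 2"] by (simp add: second_diff_choose)
    qed
    show "convex_upto k (\<lambda>a. int ((?m - a - s) choose t))"
      unfolding convex_upto_iff
    proof (intro allI impI)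
      fix x assume x: "x + 2 \<le> k"
      have "second_diff (\<lambda>a. int ((?m - a - s) choose t)) x =
          second_diff (\<lambda>a. int ((a - s) choose t)) (?m - (x + 2))"
        using x by (intro second_diff_reflect) simp
      then show "0 \<le> second_diff (\<lambda>a. int ((?m - a - s) choose t)) x"
        using second_diff_choose_diff_nonneg[OF assms(3)] by simp
    qed
    fix x
    show "0 \<le> int ((?m - x) choose s) - int (x choose s)" if "x \<le> k"
      using binomial_right_mono[of x "?m - x" s] that by simp
    show "int ((?m - (x + 1)) choose s) - int ((x + 1) choose s) \<le> int ((?m - x) choose s) - int (x choose s)"
      using binomial_right_mono[of "?m - (x + 1)" "?m - x" s] binomial_right_mono[of x "x + 1" s]
      by linarith
    show "int ((?m - (x + 1) - s) choose t) \<le> int ((?m - x - s) choose t)"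
      using binomial_right_mono[of "?m - (x + 1) - s" "?m - x - s" t] by linarith
  qed simp
  \<comment> \<open>The factor \<open>n - b\<close> becomes linear in \<open>a\<close>, and it is
    nonnegative by \<open>n \<ge> 2 * k + 1\<close>.\<close>
  have 3: "convex_upto k (\<lambda>a. (int n - int ?m + int a) *
      (int (a choose (s - 1 + t)) * int ((s - 1 + t) choose t)))"
  proof (rule convex_upto_mult_mono)
    show "convex_upto k (\<lambda>a. int (a choose (s - 1 + t)) * int ((s - 1 + t) choose t))"
      by (rule convex_upto_mult_mono)
        (auto simp: convex_upto_iff second_diff_choose binomial_right_mono simp: second_diff_def)
  qed (use assms in \<open>auto simp: convex_upto_def intro!: mult_right_mono binomial_right_mono\<close>)
  \<comment> \<open>For \<open>a \<le> k\<close> neither the difference of binomials nor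
    \<open>n - b\<close> truncates, so both pass to the integers.\<close>
  have "int (host_count s t n a (?m - a)) =
      int (a choose s) * int ((n - s) choose t) +
      (int ((?m - a) choose s) - int (a choose s)) * int ((?m - a - s) choose t) +
      (int n - int ?m + int a) * (int (a choose (s - 1 + t)) * int ((s - 1 + t) choose t))"
    if "a \<le> k" for a
  proof -
    have "(a choose s) \<le> ((?m - a) choose s)" using that by (intro binomial_right_mono) simp
    then show ?thesis using assms(1) that
      unfolding host_count_def choose_mult_choose_diff[of a "s - 1"]
      by (simp add: of_nat_diff)
  qed
  then show ?thesis
    by (rule convex_upto_cong[OF convex_upto_add[OF convex_upto_add[OF 1 2] 3]])
qed

text \<open>Only the second summand survives. In the third, \<open>0 choose (s - 1)\<close> is 1
  when \<open>s = 1\<close>, but then \<open>0 choose t\<close> vanishes.\<close>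

lemma host_count_0:
  assumes "s \<ge> 1" "t \<ge> 2"
  shows "host_count s t n 0 b = (b choose (s + t)) * ((s + t) choose t)"
  using assms choose_mult_choose_diff[of b s t] by (simp add: host_count_def binomial_eq_0)

text \<open>By Pascal's rule the second summand is one more copy of the term multiplied by
  \<open>n - (k + 1)\<close>, which raises that factor to \<open>n - k\<close>: the single vertex in
  \<open>{k..<k + 1}\<close> behaves like the isolated ones.\<close>

lemma host_count_Suc:
  assumes "s \<ge> 1" "n \<ge> k + 1"
  shows "host_count s t n k (k + 1) =
    (k choose s) * ((n - s) choose t) + (n - k) * (k choose (s + t - 1)) * ((s + t - 1) choose t)"
proof -
  obtain r where s: "s = Suc r" using assms(1) by (cases s) auto
  have "n - k = Suc (n - Suc k)" using assms(2) by simp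
  then show ?thesis
    using choose_mult_choose_diff[of k r t]
    by (simp add: host_count_def s algebra_simps)
qed

section \<open>The extremal number\<close>

lemma simple_graph_relabel:
  assumes G: "simple_graph (V, E)" and h: "bij_betw h V W"
  shows "simple_graph (W, image h ` E)"
proof -
  have "finite W" using G h bij_betw_finite by (auto simp: simple_graph_def)
  moreover have "h ` e \<subseteq> W \<and> card (h ` e) = 2" if "e \<in> E" for e
  proof -
    have e: "e \<subseteq> V" "card e = 2" using G that by (auto simp: simple_graph_def)
    then have "inj_on h e" using h by (auto simp: bij_betw_def intro: inj_on_subset)
    then show ?thesis using e h by (auto simp: card_image bij_betw_def)
  qed
  ultimately show ?thesis by (auto simp: simple_graph_def)
qed

lemma has_matching_relabel:
  assumes G: "simple_graph (V, E)" and h: "inj_on h V" and M: "has_matching (image h ` E) m"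
  shows "has_matching E m"
proof -
  obtain g where g: "inj_on g {..<2 * m}"
    and gE: "\<And>i. i < m \<Longrightarrow> {g (2 * i), g (2 * i + 1)} \<in> image h ` E"
    using M by (auto simp: has_matching_def)
  let ?k = "inv_into V h"
  have inv: "?k ` h ` e = e" if "e \<in> E" for e
    using G that h by (intro inv_into_image_cancel) (auto simp: simple_graph_def)
  have "{?k (g (2 * i)), ?k (g (2 * i + 1))} \<in> E" if "i < m" for i
  proof -
    obtain e where e: "e \<in> E" "{g (2 * i), g (2 * i + 1)} = h ` e" using gE[OF \<open>i < m\<close>] by auto
    then show ?thesis using inv[OF e(1)] by (metis image_empty image_insert)
  qed
  \<comment> \<open>Every matched vertex lies on a relabelled edge, hence in the range on which the
    inverse of \<open>h\<close> is injective.\<close>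
  moreover have "g x \<in> h ` V" if x: "x < 2 * m" for x
  proof -
    obtain i where i: "i < m" "x = 2 * i \<or> x = 2 * i + 1" using x by (rule less_double_cases)
    obtain e where "{g (2 * i), g (2 * i + 1)} = h ` e" "e \<in> E" using gE[OF i(1)] by auto
    moreover from this have "h ` e \<subseteq> h ` V" using G by (intro image_mono) (simp add: simple_graph_def)
    ultimately show ?thesis using i(2) by (metis insert_subset)
  qed
  then have "inj_on (?k \<circ> g) {..<2 * m}"
    by (intro comp_inj_on g inj_on_subset[OF inj_on_inv_into[OF subset_refl]]) auto
  ultimately show ?thesis
    unfolding has_matching_def by (intro exI[of _ "?k \<circ> g"]) simp
qed

text \<open>Taking images under \<open>h\<close> embeds the pairs, since they consist of subsets of
  \<open>V\<close>. For the upper bound this direction suffices.\<close>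

lemma card_stars_relabel:
  assumes G: "simple_graph (V, E)" and h: "bij_betw h V W" and st: "s \<ge> 1" "t \<ge> 1"
  shows "card (stars s t E) \<le> card (stars s t (image h ` E))"
proof (rule card_inj_on_le)
  have inj: "inj_on h V" using h by (simp add: bij_betw_def)
  note sub = stars_subset[OF G st]
  show "finite (stars s t (image h ` E))"
    by (rule finite_stars[OF simple_graph_relabel[OF G h] st])
  show "inj_on (map_prod (image h) (image h)) (stars s t E)"
    by (rule inj_on_subset[OF _ sub]) (intro map_prod_inj_on inj_on_image_Pow inj)
  show "map_prod (image h) (image h) ` stars s t E \<subseteq> stars s t (image h ` E)"
  proof (rule image_subsetI)
    fix P assume P: "P \<in> stars s t E"
    then obtain S T where eq: "P = (S, T)" and ST: "(S, T) \<in> stars s t E" by (cases P) simp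
    then have V: "S \<subseteq> V" "T \<subseteq> V" using sub by auto
    have "inj_on h S" "inj_on h T" using V inj by (auto intro: inj_on_subset)
    moreover have "h ` S \<inter> h ` T = {}"
      using ST inj_on_image_Int[OF inj V] by (auto simp: stars_def)
    moreover have "{u, v} \<in> image h ` E" if uv: "u \<in> h ` S" "v \<in> h ` S \<union> h ` T" "u \<noteq> v" for u v
    proof -
      obtain p q where pq: "p \<in> S" "q \<in> S \<union> T" "u = h p" "v = h q" using uv by blast
      then have "{p, q} \<in> E" using ST uv(3) by (auto simp: stars_def)
      then show ?thesis using pq by (intro image_eqI[of _ _ "{p, q}"]) auto
    qed
    ultimately show "map_prod (image h) (image h) P \<in> stars s t (image h ` E)"
      using ST by (simp add: stars_def card_image eq)
  qed
qed

text \<open>The upper bound: relabelling, stabilising and enlarging to a host graph never decrease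
  the count, and convexity moves \<open>a\<close> to an end of \<open>{0..k}\<close>.\<close>

lemma card_stars_le:
  assumes G: "simple_graph (V, E)" "\<not> has_matching E (k + 1)"
    and st: "s \<ge> 1" "t \<ge> 1" and n: "card V = n" "n \<ge> 2 * k + 1"
  shows "card (stars s t E) \<le>
    max (host_count s t n 0 (2 * k + 1)) (host_count s t n k (k + 1))"
proof -
  have "finite V" using G by (simp add: simple_graph_def)
  then obtain h where h: "bij_betw h V {..<n}"
    using ex_bij_betw_finite_nat n(1) by (metis atLeast0LessThan)
  have "\<not> has_matching (image h ` E) (k + 1)"
    using has_matching_relabel[OF G(1) bij_betw_imp_inj_on[OF h]] G(2) by auto
  then obtain E' where E': "simple_graph ({..<n}, E')" "\<not> has_matching E' (k + 1)" "stable E'"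
    "card (stars s t (image h ` E)) \<le> card (stars s t E')"
    using exists_stable[OF simple_graph_relabel[OF G(1) h] _ st] by blast
  obtain a where a: "a \<le> k" "E' \<subseteq> host n a (2 * k + 1 - a)"
    using stable_subset_host[OF E'(1,3,2)] by auto
  have "card (stars s t E) \<le> card (stars s t E')"
    using card_stars_relabel[OF G(1) h st] E'(4) by (rule order_trans)
  also have "\<dots> \<le> card (stars s t (host n a (2 * k + 1 - a)))"
    by (intro card_mono stars_mono a finite_stars[OF simple_graph_host st])
  also have "\<dots> = host_count s t n a (2 * k + 1 - a)"
    using a(1) n(2) st by (intro card_stars_host) auto
  also have "\<dots> \<le> max (host_count s t n 0 (2 * k + 1)) (host_count s t n k (k + 1))"
    using convex_upto_le_max[OF convex_upto_host_count[OF n(2) st] a(1)]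
    by (simp add: le_max_iff_disj)
  finally show ?thesis .
qed

text \<open>The lower bound: with \<open>b = 2 * k + 1 - a\<close> the total weight
  \<open>a + b\<close> is \<open>2 * k + 1\<close>, just below the \<open>2 * (k + 1)\<close> that a
  forbidden matching needs.\<close>

lemma host_count_in_copy_counts:
  assumes "s \<ge> 1" "t \<ge> 2" "a \<le> k" "n \<ge> 2 * k + 1"
  shows "host_count s t n a (2 * k + 1 - a) \<in> copy_counts n (K_star s t) (matching_graph (k + 1))"
proof -
  let ?G = "({..<n}, host n a (2 * k + 1 - a))"
  note G = simple_graph_host[of n a "2 * k + 1 - a"]
  have "\<not> has_matching (host n a (2 * k + 1 - a)) (k + 1)"
    using assms by (intro host_no_matching) auto
  then have "copies (matching_graph (k + 1)) ?G = {}"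
    using copies_matching_graph_nonempty_iff[OF G, of "k + 1"] by auto
  moreover have "card (copies (K_star s t) ?G) = host_count s t n a (2 * k + 1 - a)"
    using card_copies_K_star[OF G assms(1,2)] card_stars_host[of a "2 * k + 1 - a" n s t] assms
    by simp
  ultimately show ?thesis
    unfolding copy_counts_def using G by (intro CollectI exI[of _ ?G]) auto
qed

theorem theorem1p3:
  fixes k s t n :: nat
  assumes "k \<ge> 1" and "s \<ge> 1" and "t \<ge> 2" and "n \<ge> 2 * k + 1"
  shows "ex n (K_star s t) (matching_graph (k + 1)) =
    max (((2 * k + 1) choose (s + t)) * ((s + t) choose t))
        ((k choose s) * ((n - s) choose t) +
         (n - k) * (k choose (s + t - 1)) * ((s + t - 1) choose t))"
proof -
  let ?C = "copy_counts n (K_star s t) (matching_graph (k + 1))"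
  let ?m = "max (host_count s t n 0 (2 * k + 1)) (host_count s t n k (k + 1))"
  have k: "2 * k + 1 - 0 = 2 * k + 1" "2 * k + 1 - k = k + 1" by simp_all
  \<comment> \<open>The host graphs with \<open>a = 0\<close> and \<open>a = k\<close> realise the
    two terms.\<close>
  have "host_count s t n 0 (2 * k + 1) \<in> ?C" "host_count s t n k (k + 1) \<in> ?C"
    using host_count_in_copy_counts[OF assms(2,3) le0 assms(4)]
      host_count_in_copy_counts[OF assms(2,3) order_refl assms(4)] unfolding k by auto
  then have "?m \<in> ?C" by (simp add: max_def)
  moreover have "c \<le> ?m" if c_mem: "c \<in> ?C" for c
  proof -
    obtain G :: "nat ugraph" where G: "simple_graph G" "card (verts G) = n"
      "copies (matching_graph (k + 1)) G = {}" and c: "c = card (copies (K_star s t) G)"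
      using c_mem by (auto simp: copy_counts_def)
    then have "\<not> has_matching (edges G) (k + 1)"
      using copies_matching_graph_nonempty_iff[OF G(1), of "k + 1"] by auto
    then have "card (stars s t (edges G)) \<le> ?m"
      using G assms by (intro card_stars_le[of "verts G"]) auto
    then show ?thesis using card_copies_K_star[OF G(1) assms(2,3)] c by simp
  qed
  ultimately have "Max ?C = ?m"
    by (intro Max_eqI finite_copy_counts)
  moreover have "n \<ge> k + 1" using assms(1,4) by simp
  ultimately show ?thesis
    unfolding ex_def using host_count_0[OF assms(2,3)] host_count_Suc[OF assms(2)] by metis
qed

end
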